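(* Let $D$ be a doubly regular $(m,r)$-team tournament of type II, and let $n=mr$. If $n\ge 27$, then $$\zeta(D)\le\dim(D)\le\lceil 4\log n\rceil .$$
   Context: $\log$ is the natural logarithm. Throughout $m>1$ and $r>1$. An $(m,r)$-team tournament is an orientation of the complete multipartite graph with $m$ parts $V_1,\dots,V_m$ (independent sets) each of size $r$. It is a doubly regular $(m,r)$-team tournament if it is $k$-regular for some $k$ (every in-degree and out-degree is $k$) and there are constants $\alpha,\beta,\gamma$ such that for distinct vertices $x,y$ the number of directed paths of length $2$ from $x$ to $y$ is $\alpha$ if there is an arc from $x$ to $y$, $\beta$ if there is an arc from $y$ to $x$, and $\gamma$ if there is no arc between $x$ and $y$. It is of type II if, for all $i\ne j$, every vertex in $V_i$ dominates (has as out-neighbours) exactly half of the vertices in $V_j$. Distance $d(w,u)$ in a digraph is the length of a shortest directed path from $w$ to $u$, taken to be $\infty$ if there is none. A resolving set of $D$ is a set $R\subseteq V(D)$ such that for each pair of distinct vertices $u,v\notin R$ there is $w\in R$ with $d(w,u)\ne d(w,v)$. The metric dimension $\dim(D)$ is the least size of a resolving set. Localization game on $D$: one player controls a set of cops, the other an invisible robber. The robber first chooses an initial vertex. In each subsequent round the cops move (each cop may choose any vertex to occupy), and then the robber moves along an arc to an out-neighbour or stays. After each robber move, if the cops occupy $u_1,\dots,u_j$, they receive the vector of distances $d(u_i,x)$, $1\le i\le j$, where $x$ is the robber's vertex. The robber is located if in some round there is a unique vertex the robber can occupy that corresponds to the distance vector received (the cops may use information from previous rounds). The localization number $\zeta(D)$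 is the minimum number of cops for which there is a strategy guaranteed to locate the robber in a finite number of rounds. *)

theory Defs
  imports Complex_Main "HOL-Library.Disjoint_Sets" "Graph_Theory.Graph_Theory"
begin

section \<open>Team tournaments\<close>

text \<open>
  The parts are \<open>V 1, \<dots>, V m\<close>; values of \<open>V\<close> outside \<open>{1..m}\<close> are irrelevant.
\<close>

locale team_tournament = digraph G
  for G :: "('a, 'b) pre_digraph" (structure) +
  fixes m r :: nat and V :: "nat \<Rightarrow> 'a set"
  assumes m_gt_1: "m > 1"
    and r_gt_1: "r > 1"
    and verts_eq: "verts G = (\<Union>i\<in>{1..m}. V i)"
    and disjoint_parts: "disjoint_family_on V {1..m}"
    and card_part: "i \<in> {1..m} \<Longrightarrow> card (V i) = r"
    and independent_part: "i \<in> {1..m} \<Longrightarrow> x \<in> V i \<Longrightarrow> y \<in> V i \<Longrightarrow> \<not> x \<rightarrow> y"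
    and oriented: "i \<in> {1..m} \<Longrightarrow> j \<in> {1..m} \<Longrightarrow> i \<noteq> j \<Longrightarrow> x \<in> V i \<Longrightarrow> y \<in> V j \<Longrightarrow>
      (x \<rightarrow> y) \<noteq> (y \<rightarrow> x)"

definition num_2_paths :: "('a, 'b) pre_digraph \<Rightarrow> 'a \<Rightarrow> 'a \<Rightarrow> nat" where
  "num_2_paths G x y = card {p. pre_digraph.apath G x p y \<and> length p = 2}"

locale doubly_regular_team_tournament = team_tournament +
  assumes regular: "\<exists>k. \<forall>x \<in> verts G. in_degree G x = k \<and> out_degree G x = k"
    and doubly_regular: "\<exists>\<alpha> \<beta> \<gamma>. \<forall>x \<in> verts G. \<forall>y \<in> verts G. x \<noteq> y \<longrightarrow>
      num_2_paths G x y = (if x \<rightarrow> y then \<alpha> else if y \<rightarrow> x then \<beta> else \<gamma>)"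

locale doubly_regular_team_tournament_type_II = doubly_regular_team_tournament +
  assumes dominates_half: "i \<in> {1..m} \<Longrightarrow> j \<in> {1..m} \<Longrightarrow> i \<noteq> j \<Longrightarrow> x \<in> V i \<Longrightarrow>
      2 * card {y \<in> V j. x \<rightarrow> y} = card (V j)"

section \<open>Distance and metric dimension\<close>

text \<open>
  The library's shortest-path cost with unit weights. It is an infimum over walks;
  the lemma below shows that this is the infimum of the lengths of paths
  (\<open>\<infinity>\<close> if there is none).
\<close>

definition distance :: "('a, 'b) pre_digraph \<Rightarrow> 'a \<Rightarrow> 'a \<Rightarrow> ereal" where
  "distance G w u = wf_digraph.\<mu> G (\<lambda>_. 1) w u"

lemma (in wf_digraph) distance_eq_INF_apath:
  "distance G w u = (INF p \<in> {p. apath w p u}. ereal (length p))"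
proof -
  have cost: "awalk_cost (\<lambda>_. 1) p = real (length p)" for p :: "'b list"
    by (simp add: awalk_cost_def sum_list_triv)
  have eq: "distance G w u = (INF p \<in> {p. awalk w p u}. ereal (length p))"
    by (simp add: distance_def \<mu>_def cost)
  show ?thesis unfolding eq
  proof (rule antisym)
    show "(INF p \<in> {p. awalk w p u}. ereal (length p)) \<le> (INF p \<in> {p. apath w p u}. ereal (length p))"
      by (rule INF_superset_mono) (auto simp: apath_def)
    show "(INF p \<in> {p. apath w p u}. ereal (length p)) \<le> (INF p \<in> {p. awalk w p u}. ereal (length p))"
    proof (rule INF_mono)
      fix p assume "p \<in> {p. awalk w p u}"
      then have p: "awalk w p u" by simp
      have "length (awalk_to_apath p) \<le> length p"
        using p
      proof (induct rule: awalk_to_apath_induct)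
        case (path p)
        then show ?case by (auto simp: awalk_to_apath.simps)
      next
        case (decomp p q s t)
        then have "awalk_to_apath p = awalk_to_apath (q @ t)" by (intro step_awalk_to_apath)
        moreover have "length (q @ t) \<le> length p"
          using decomp by (auto elim!: awalk_cyc_decompE)
        ultimately show ?case using decomp by simp
      qed
      with apath_awalk_to_apath[OF p]
      show "\<exists>q \<in> {p. apath w p u}. ereal (length q) \<le> ereal (length p)" by auto
    qed
  qed
qed

definition resolving_set :: "('a, 'b) pre_digraph \<Rightarrow> 'a set \<Rightarrow> bool" where
  "resolving_set G R \<longleftrightarrow> R \<subseteq> verts G \<and>
    (\<forall>u \<in> verts G - R. \<forall>v \<in> verts G - R. u \<noteq> v \<longrightarrow>
      (\<exists>w \<in> R. distance G w u \<noteq> distance G w v))"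

definition metric_dimension :: "('a, 'b) pre_digraph \<Rightarrow> nat" where
  "metric_dimension G = (LEAST k. \<exists>R. resolving_set G R \<and> card R = k)"

section \<open>The localization game\<close>

text \<open>
  \<open>\<rho> 0\<close> is the robber's initial vertex and \<open>\<rho> t\<close> his vertex after his move in round \<open>t \<ge> 1\<close>.
\<close>

definition robber_play :: "('a, 'b) pre_digraph \<Rightarrow> (nat \<Rightarrow> 'a) \<Rightarrow> bool" where
  "robber_play G \<rho> \<longleftrightarrow> \<rho> 0 \<in> verts G \<and> (\<forall>t. \<rho> (Suc t) = \<rho> t \<or> \<rho> t \<rightarrow>\<^bsub>G\<^esub> \<rho> (Suc t))"

text \<open>
  The robber is invisible, so a strategy chooses the positions of the \<open>k\<close> cops for the next round
  from the list of the distance vectors received in the previous rounds.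
\<close>

definition cop_strategy ::
    "('a, 'b) pre_digraph \<Rightarrow> nat \<Rightarrow> (ereal list list \<Rightarrow> 'a list) \<Rightarrow> bool" where
  "cop_strategy G k \<sigma> \<longleftrightarrow> (\<forall>h. length (\<sigma> h) = k \<and> set (\<sigma> h) \<subseteq> verts G)"

definition distance_vector :: "('a, 'b) pre_digraph \<Rightarrow> 'a list \<Rightarrow> 'a \<Rightarrow> ereal list" where
  "distance_vector G us x = map (\<lambda>u. distance G u x) us"

fun received :: "('a, 'b) pre_digraph \<Rightarrow> (ereal list list \<Rightarrow> 'a list) \<Rightarrow> (nat \<Rightarrow> 'a) \<Rightarrow> nat
    \<Rightarrow> ereal list list" where
  "received G \<sigma> \<rho> 0 = []"
| "received G \<sigma> \<rho> (Suc t) =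
    received G \<sigma> \<rho> t @ [distance_vector G (\<sigma> (received G \<sigma> \<rho> t)) (\<rho> (Suc t))]"

definition possible_positions :: "('a, 'b) pre_digraph \<Rightarrow> (ereal list list \<Rightarrow> 'a list)
    \<Rightarrow> (nat \<Rightarrow> 'a) \<Rightarrow> nat \<Rightarrow> 'a set" where
  "possible_positions G \<sigma> \<rho> t =
    {\<rho>' t | \<rho>'. robber_play G \<rho>' \<and> received G \<sigma> \<rho>' t = received G \<sigma> \<rho> t}"

definition locating_strategy ::
    "('a, 'b) pre_digraph \<Rightarrow> (ereal list list \<Rightarrow> 'a list) \<Rightarrow> bool" where
  "locating_strategy G \<sigma> \<longleftrightarrow>
    (\<forall>\<rho>. robber_play G \<rho> \<longrightarrow> (\<exists>t\<ge>1. \<exists>!x. x \<in> possible_positions G \<sigma> \<rho> t))"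

definition localization_number :: "('a, 'b) pre_digraph \<Rightarrow> nat" where
  "localization_number G = (LEAST k. \<exists>\<sigma>. cop_strategy G k \<sigma> \<and> locating_strategy G \<sigma>)"

end

theory Submission
  imports Defs
begin

text \<open>
  For the first inequality, the vector of distances from a resolving set determines the vertex, so
  cops placed on such a set locate the robber in the first round.

  The second inequality is a covering argument. The vertices at distance 1 from \<open>w\<close> are the ones it
  dominates, so \<open>w\<close> separates \<open>x\<close> and \<open>y\<close> as soon as it dominates exactly one of them. In a doubly
  regular team tournament of type II at least half of all vertices do so, for every pair
  \<open>x \<noteq> y\<close>. If the pair lies in two parts, counting 2-paths from a vertex to a part evaluates
  \<open>\<alpha> + \<beta>\<close>, and exactly half of the vertices separate it (\<open>half_distinguish_different_parts\<close>). If it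
  lies in one part, the number of separating vertices is \<open>2 * \<gamma>\<close> with
  \<open>4 * (r - 1) * \<gamma> = (m - 1) * r\<^sup>2\<close>. By itself this is only about a quarter of the order when
  \<open>m = 2\<close> and \<open>r\<close> is large; but \<open>\<gamma>\<close> is an integer, which forces \<open>r - 1\<close> to divide \<open>m - 1\<close>, hence
  \<open>r \<le> m\<close>, and then \<open>2 * \<gamma>\<close> is at least half of the order (\<open>half_distinguish_same_part\<close>).

  Consequently some vertex separates at least half of any given set of pairs, and choosing
  vertices greedily halves the unseparated pairs each time (\<open>halving_hitting_set\<close>). With fewer
  than \<open>n\<^sup>2\<close> pairs, \<open>s\<close> choices suffice once \<open>2 ^ s \<ge> n\<^sup>2\<close>, and \<open>s = \<lceil>4 * ln n\<rceil>\<close> satisfies this.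
\<close>

section \<open>Distances and the localization game\<close>

context digraph
begin

lemma distance_self: "w \<in> verts G \<Longrightarrow> distance G w w = 0"
  unfolding distance_eq_INF_apath
proof (rule antisym)
  assume "w \<in> verts G"
  then have "[] \<in> {p. apath w p w}" by (simp add: apath_def awalk_def)
  then have "(INF p \<in> {p. apath w p w}. ereal (length p)) \<le> ereal (length ([] :: 'b list))"
    by (rule INF_lower)
  then show "(INF p \<in> {p. apath w p w}. ereal (length p)) \<le> 0"
    by (simp add: zero_ereal_def)
qed (simp add: INF_greatest)

lemma distance_ge_1: "w \<noteq> u \<Longrightarrow> distance G w u \<ge> 1"
  unfolding distance_eq_INF_apath
proof (rule INF_greatest)
  fix p assume "w \<noteq> u" "p \<in> {p. apath w p u}"
  then have "length p \<ge> 1" by (cases p) (auto simp: apath_def awalk_def)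
  then show "1 \<le> ereal (length p)" by simp
qed

lemma distance_dominated: "w \<rightarrow> u \<Longrightarrow> distance G w u = 1"
proof (rule antisym)
  assume wu: "w \<rightarrow> u"
  then have "w \<noteq> u" using adj_not_same by blast
  then show "distance G w u \<ge> 1" by (rule distance_ge_1)
  obtain a where a: "a \<in> arcs G" "tail G a = w" "head G a = u"
    using wu by (auto simp: arcs_ends_def arc_to_ends_def)
  then have "[a] \<in> {p. apath w p u}"
    using \<open>w \<noteq> u\<close> by (auto simp: apath_def awalk_def)
  then have "(INF p \<in> {p. apath w p u}. ereal (length p)) \<le> ereal (length [a])"
    by (rule INF_lower)
  then show "distance G w u \<le> 1" unfolding distance_eq_INF_apath by (simp add: one_ereal_def)
qed

lemma distance_ge_2: "w \<noteq> u \<Longrightarrow> \<not> w \<rightarrow> u \<Longrightarrow> distance G w u \<ge> 2"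
  unfolding distance_eq_INF_apath
proof (rule INF_greatest)
  fix p assume *: "w \<noteq> u" "\<not> w \<rightarrow> u" "p \<in> {p. apath w p u}"
  have "length p \<ge> 2"
  proof (rule ccontr)
    assume "\<not> length p \<ge> 2"
    then consider "p = []" | a where "p = [a]" by (cases p; cases "tl p") auto
    then show False
      using * by cases (auto simp: apath_def awalk_def dest: in_arcs_imp_in_arcs_ends)
  qed
  then show "2 \<le> ereal (length p)" by simp
qed

lemma distance_eq_1_iff:
  assumes "w \<in> verts G"
  shows "distance G w u = 1 \<longleftrightarrow> w \<rightarrow> u"
proof
  assume "distance G w u = 1"
  then show "w \<rightarrow> u"
    using distance_self[OF assms] distance_ge_2[of w u] by (cases "w = u") force+
qed (rule distance_dominated)

text \<open>
  A vertex of \<open>R\<close> is the only one at distance 0 from itself, so a resolving set separates all pairs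
  of vertices by their distance vectors, not just the pairs outside \<open>R\<close>.
\<close>

lemma resolving_set_distance_inj:
  assumes R: "resolving_set G R" and uv: "u \<in> verts G" "v \<in> verts G"
    and eq: "\<And>w. w \<in> R \<Longrightarrow> distance G w u = distance G w v"
  shows "u = v"
proof (rule ccontr)
  assume ne: "u \<noteq> v"
  have "\<not> (u \<in> R \<or> v \<in> R)"
    using eq[of u] eq[of v] distance_self distance_ge_1[of u v] distance_ge_1[of v u] uv ne
    by force
  then show False using R uv ne eq unfolding resolving_set_def by blast
qed

lemma robber_play_in_verts: "robber_play G \<rho> \<Longrightarrow> \<rho> t \<in> verts G"
proof (induct t)
  case (Suc t)
  then show ?case unfolding robber_play_def by (metis adj_in_verts(2))
qed (simp add: robber_play_def)

text \<open>
  Cops that occupy a resolving set read off the robber's vertex in the first round.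
\<close>

lemma localization_number_le_card_resolving_set:
  assumes R: "resolving_set G R"
  shows "localization_number G \<le> card R"
proof -
  have "R \<subseteq> verts G" using R by (simp add: resolving_set_def)
  then obtain us where us: "set us = R" "distinct us"
    using finite_distinct_list finite_subset finite_verts by metis
  define \<sigma> where "\<sigma> = (\<lambda>h :: ereal list list. us)"
  have "cop_strategy G (card R) \<sigma>"
    using us \<open>R \<subseteq> verts G\<close> by (auto simp: cop_strategy_def \<sigma>_def distinct_card)
  moreover have "locating_strategy G \<sigma>"
    unfolding locating_strategy_def
  proof (intro allI impI)
    fix \<rho> assume \<rho>: "robber_play G \<rho>"
    have "possible_positions G \<sigma> \<rho> 1 = {\<rho> 1}"
    proof (intro equalityI subsetI)
      fix x assume "x \<in> possible_positions G \<sigma> \<rho> 1"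
      then obtain \<rho>' where \<rho>': "x = \<rho>' 1" "robber_play G \<rho>'"
        "distance_vector G us (\<rho>' 1) = distance_vector G us (\<rho> 1)"
        by (auto simp: possible_positions_def \<sigma>_def)
      have "\<rho>' 1 = \<rho> 1"
        by (rule resolving_set_distance_inj[OF R])
          (use \<rho> \<rho>' us in \<open>auto simp: robber_play_in_verts distance_vector_def\<close>)
      then show "x \<in> {\<rho> 1}" using \<rho>' by simp
    qed (use \<rho> in \<open>auto simp: possible_positions_def\<close>)
    then show "\<exists>t\<ge>1. \<exists>!x. x \<in> possible_positions G \<sigma> \<rho> t" by (intro exI[of _ 1]) simp
  qed
  ultimately show ?thesis
    unfolding localization_number_def by (intro Least_le) blast
qed

lemma metric_dimension_attained: "\<exists>R. resolving_set G R \<and> card R = metric_dimension G"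
  unfolding metric_dimension_def
proof (rule LeastI)
  show "\<exists>R. resolving_set G R \<and> card R = card (verts G)"
    by (intro exI[of _ "verts G"]) (simp add: resolving_set_def)
qed

lemma metric_dimension_le_card: "resolving_set G R \<Longrightarrow> metric_dimension G \<le> card R"
  unfolding metric_dimension_def by (rule Least_le) blast

lemma localization_number_le_metric_dimension: "localization_number G \<le> metric_dimension G"
  using metric_dimension_attained localization_number_le_card_resolving_set by metis

text \<open>
  An apath is a list of arcs; without parallel arcs, one of length 2 amounts to its middle vertex.
\<close>

lemma num_2_paths_eq_card:
  assumes "x \<noteq> y"
  shows "num_2_paths G x y = card {z. x \<rightarrow> z \<and> z \<rightarrow> y}"
proof -
  have "bij_betw (\<lambda>p. head G (hd p)) {p. apath x p y \<and> length p = 2} {z. x \<rightarrow> z \<and> z \<rightarrow> y}"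
  proof (rule bij_betw_imageI)
    show "inj_on (\<lambda>p. head G (hd p)) {p. apath x p y \<and> length p = 2}"
    proof (rule inj_onI)
      fix p q
      assume p: "p \<in> {p. apath x p y \<and> length p = 2}" and q: "q \<in> {p. apath x p y \<and> length p = 2}"
        and eq: "head G (hd p) = head G (hd q)"
      obtain a b where pab: "p = [a, b]"
        using p by (auto simp: length_Suc_conv numeral_2_eq_2)
      obtain c d where qcd: "q = [c, d]"
        using q by (auto simp: length_Suc_conv numeral_2_eq_2)
      have "a = c" "b = d"
        using p q eq no_multi_arcs[of a c] no_multi_arcs[of b d]
        by (auto simp: pab qcd apath_def awalk_def arc_to_ends_def)
      then show "p = q" by (simp add: pab qcd)
    qed
    show "(\<lambda>p. head G (hd p)) ` {p. apath x p y \<and> length p = 2} = {z. x \<rightarrow> z \<and> z \<rightarrow> y}"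
    proof (intro equalityI subsetI)
      fix z assume "z \<in> (\<lambda>p. head G (hd p)) ` {p. apath x p y \<and> length p = 2}"
      then obtain p where p: "apath x p y" "length p = 2" "z = head G (hd p)" by auto
      then obtain a b where "p = [a, b]" by (auto simp: length_Suc_conv numeral_2_eq_2)
      with p show "z \<in> {z. x \<rightarrow> z \<and> z \<rightarrow> y}"
        by (auto simp: apath_def awalk_def dest!: in_arcs_imp_in_arcs_ends)
    next
      fix z assume z: "z \<in> {z. x \<rightarrow> z \<and> z \<rightarrow> y}"
      then obtain a b where ab: "a \<in> arcs G" "tail G a = x" "head G a = z"
        "b \<in> arcs G" "tail G b = z" "head G b = y"
        by (auto simp: arcs_ends_def arc_to_ends_def)
      have "z \<noteq> x" "z \<noteq> y" using z adj_not_same by blast+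
      then have "apath x [a, b] y"
        using ab assms by (auto simp: apath_def awalk_def)
      then show "z \<in> (\<lambda>p. head G (hd p)) ` {p. apath x p y \<and> length p = 2}"
        using ab by (intro image_eqI[of _ _ "[a, b]"]) auto
    qed
  qed
  then show ?thesis unfolding num_2_paths_def by (rule bij_betw_same_card)
qed

end

section \<open>Small hitting sets by repeated halving\<close>

text \<open>
  If each \<open>p\<close> is hit by at least half of \<open>W\<close>, then by double counting some element of \<open>W\<close> hits at
  least half of the points not hit so far. Each such choice halves what is left.
\<close>

lemma halving_hitting_set:
  fixes hits :: "'w \<Rightarrow> 'p \<Rightarrow> bool"
  assumes finW: "finite W" and finP: "finite P" and ne: "W \<noteq> {}"
    and half: "\<And>p. p \<in> P \<Longrightarrow> card W \<le> 2 * card {w \<in> W. hits w p}"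
  shows "\<exists>R \<subseteq> W. card R \<le> s \<and> 2 ^ s * card {p \<in> P. \<forall>w \<in> R. \<not> hits w p} \<le> card P"
proof (induct s)
  case 0
  show ?case by (intro exI[of _ "{}"]) simp
next
  case (Suc s)
  then obtain R where R: "R \<subseteq> W" "card R \<le> s"
    and left: "2 ^ s * card {p \<in> P. \<forall>w \<in> R. \<not> hits w p} \<le> card P" by blast
  define Q where "Q = {p \<in> P. \<forall>w \<in> R. \<not> hits w p}"
  have finQ: "finite Q" using finP by (simp add: Q_def)
  have "\<exists>w \<in> W. card Q \<le> 2 * card {p \<in> Q. hits w p}"
  proof (rule ccontr)
    assume "\<not> ?thesis"
    then have "(\<Sum>w\<in>W. 2 * card {p \<in> Q. hits w p}) < (\<Sum>w\<in>W. card Q)"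
      by (intro sum_strict_mono[OF finW ne]) (simp add: not_le)
    moreover have "(\<Sum>w\<in>W. card {p \<in> Q. hits w p}) = (\<Sum>p\<in>Q. card {w \<in> W. hits w p})"
      by (rule sum_multicount_gen[OF finW finQ]) simp
    moreover have "(\<Sum>p\<in>Q. card W) \<le> (\<Sum>p\<in>Q. 2 * card {w \<in> W. hits w p})"
      by (rule sum_mono) (use half in \<open>auto simp: Q_def\<close>)
    ultimately show False by (simp flip: sum_distrib_left add: mult.commute)
  qed
  then obtain w where w: "w \<in> W" "card Q \<le> 2 * card {p \<in> Q. hits w p}" by blast
  have "card {p \<in> Q. hits w p} + card {p \<in> Q. \<not> hits w p} = card Q"
    using finQ by (subst card_Un_disjoint[symmetric]) (auto intro: arg_cong[where f = card])
  with w have "2 * card {p \<in> Q. \<not> hits w p} \<le> card Q" by linarith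
  then have "2 ^ s * (2 * card {p \<in> Q. \<not> hits w p}) \<le> 2 ^ s * card Q" by (rule mult_le_mono2)
  moreover have "{p \<in> P. \<forall>v \<in> insert w R. \<not> hits v p} = {p \<in> Q. \<not> hits w p}"
    by (auto simp: Q_def)
  ultimately have "2 ^ Suc s * card {p \<in> P. \<forall>v \<in> insert w R. \<not> hits v p} \<le> card P"
    using left unfolding Q_def[symmetric] by (simp only: power_Suc mult_ac)
  moreover have "card (insert w R) \<le> Suc s"
    using R by (intro card_insert_le_m1) auto
  ultimately show ?case using R w by (intro exI[of _ "insert w R"]) simp
qed

section \<open>In-neighbourhoods differ in half of all vertices\<close>

context doubly_regular_team_tournament_type_II
begin

lemma finite_part: "i \<in> {1..m} \<Longrightarrow> finite (V i)"
  using card_part r_gt_1 by (metis card.infinite not_less_zero)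

lemma card_verts: "card (verts G) = m * r"
  unfolding verts_eq
  using disjoint_parts finite_part card_part
  by (subst card_UN_disjoint) (auto simp: disjoint_family_on_def)

lemma part_unique: "x \<in> V i \<Longrightarrow> x \<in> V j \<Longrightarrow> i \<in> {1..m} \<Longrightarrow> j \<in> {1..m} \<Longrightarrow> i = j"
  using disjoint_parts unfolding disjoint_family_on_def by blast

lemma part_in_verts: "i \<in> {1..m} \<Longrightarrow> x \<in> V i \<Longrightarrow> x \<in> verts G"
  by (auto simp: verts_eq)

lemma adj_asym: "x \<rightarrow> y \<Longrightarrow> \<not> y \<rightarrow> x"
proof
  assume xy: "x \<rightarrow> y" "y \<rightarrow> x"
  then obtain i j where "i \<in> {1..m}" "x \<in> V i" "j \<in> {1..m}" "y \<in> V j"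
    using adj_in_verts[of x y] by (auto simp: verts_eq)
  then show False using xy oriented[of i j x y] independent_part[of i x y] by (cases "i = j") auto
qed

lemma dominated_by_half:
  assumes "i \<in> {1..m}" "j \<in> {1..m}" "i \<noteq> j" "x \<in> V i"
  shows "2 * card {y \<in> V j. y \<rightarrow> x} = r"
proof -
  have "card {y \<in> V j. x \<rightarrow> y} + card {y \<in> V j. y \<rightarrow> x} = card (V j)"
    using finite_part[OF assms(2)] oriented[OF assms(1,2,3,4)]
    by (subst card_Un_disjoint[symmetric]) (auto intro: arg_cong[where f = card])
  then show ?thesis using dominates_half[OF assms] card_part[OF assms(2)] by linarith
qed

lemma card_dominated_in_parts:
  assumes i: "i \<in> {1..m}" "x \<in> V i" and I: "I \<subseteq> {1..m} - {i}"
  shows "2 * card {y \<in> \<Union>(V ` I). x \<rightarrow> y} = card I * r"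
proof -
  have "{y \<in> \<Union>(V ` I). x \<rightarrow> y} = (\<Union>l\<in>I. {y \<in> V l. x \<rightarrow> y})" by auto
  also have "card \<dots> = (\<Sum>l\<in>I. card {y \<in> V l. x \<rightarrow> y})"
  proof (rule card_UN_disjoint)
    show "finite I" using I by (meson finite_Diff finite_atLeastAtMost finite_subset)
    show "\<forall>l\<in>I. finite {y \<in> V l. x \<rightarrow> y}" using I finite_part by auto
    show "\<forall>l\<in>I. \<forall>l'\<in>I. l \<noteq> l' \<longrightarrow> {y \<in> V l. x \<rightarrow> y} \<inter> {y \<in> V l'. x \<rightarrow> y} = {}"
      using I part_unique by blast
  qed
  also have "2 * \<dots> = (\<Sum>l\<in>I. r)"
    unfolding sum_distrib_left
  proof (rule sum.cong)
    fix l assume "l \<in> I"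
    then have "l \<in> {1..m}" "i \<noteq> l" using I by auto
    then show "2 * card {y \<in> V l. x \<rightarrow> y} = r"
      using dominates_half[OF i(1) _ _ i(2)] card_part by simp
  qed simp
  finally show ?thesis by simp
qed

text \<open>
  The middle vertices of the walks of length 2 from \<open>x\<close> to the part \<open>V j\<close> are the out-neighbours
  of \<open>x\<close> outside \<open>V j\<close>, half of each remaining part, and each of these dominates half of \<open>V j\<close>.
\<close>

lemma sum_card_2_walks_to_part:
  assumes i: "i \<in> {1..m}" "x \<in> V i" and j: "j \<in> {1..m}"
  shows "4 * (\<Sum>y\<in>V j. card {z. x \<rightarrow> z \<and> z \<rightarrow> y}) = card ({1..m} - {i, j}) * r * r"
proof -
  define M where "M = {z. x \<rightarrow> z}"
  have M: "M \<subseteq> verts G" by (auto simp: M_def)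
  then have finM: "finite M" by (rule finite_subset) simp
  let ?K = "{z \<in> \<Union>(V ` ({1..m} - {i, j})). x \<rightarrow> z}"
  \<comment> \<open>\<open>V i\<close> is left out as well, because \<open>x\<close> dominates nothing in its own part.\<close>
  have K: "{z \<in> M. z \<notin> V j} = ?K"
  proof (intro equalityI subsetI)
    fix z assume z: "z \<in> {z \<in> M. z \<notin> V j}"
    then obtain l where l: "l \<in> {1..m}" "z \<in> V l" using M by (auto simp: verts_eq)
    then have "l \<noteq> i" "l \<noteq> j" using z independent_part[OF i] by (auto simp: M_def)
    then show "z \<in> ?K" using z l by (auto simp: M_def)
  next
    fix z assume z: "z \<in> ?K"
    then obtain l where "l \<in> {1..m}" "l \<noteq> j" "z \<in> V l" by blast
    then show "z \<in> {z \<in> M. z \<notin> V j}" using z part_unique[of z l j] j by (auto simp: M_def)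
  qed
  have "(\<Sum>y\<in>V j. card {z. x \<rightarrow> z \<and> z \<rightarrow> y}) = (\<Sum>y\<in>V j. card {z\<in>M. z \<rightarrow> y})"
    by (simp add: M_def)
  also have "\<dots> = (\<Sum>z\<in>M. card {y \<in> V j. z \<rightarrow> y})"
    by (rule sum_multicount_gen[OF finite_part[OF j] finM]) simp
  also have "4 * \<dots> = (\<Sum>z\<in>M. if z \<notin> V j then 2 * r else 0)"
    unfolding sum_distrib_left
  proof (rule sum.cong)
    fix z assume "z \<in> M"
    then obtain l where l: "l \<in> {1..m}" "z \<in> V l" using M by (auto simp: verts_eq)
    show "4 * card {y \<in> V j. z \<rightarrow> y} = (if z \<notin> V j then 2 * r else 0)"
    proof (cases "z \<in> V j")
      case True
      then have "{y \<in> V j. z \<rightarrow> y} = {}" using independent_part[OF j] by auto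
      then have "card {y \<in> V j. z \<rightarrow> y} = 0" by (simp only: card.empty)
      then show ?thesis using True by simp
    next
      case False
      then have "l \<noteq> j" using l by auto
      then show ?thesis using False dominates_half[OF l(1) j _ l(2)] card_part[OF j] by simp
    qed
  qed simp
  also have "\<dots> = card ?K * (2 * r)"
    unfolding K[symmetric] by (simp add: sum.inter_filter[OF finM, symmetric])
  also have "\<dots> = (2 * card ?K) * r" by simp
  also have "2 * card ?K = card ({1..m} - {i, j}) * r"
    by (rule card_dominated_in_parts[OF i]) auto
  finally show ?thesis .
qed

lemma card_differing_in_neighbours:
  "card {w \<in> verts G. (w \<rightarrow> x) \<noteq> (w \<rightarrow> y)} =
    card {w. w \<rightarrow> x \<and> \<not> w \<rightarrow> y} + card {w. w \<rightarrow> y \<and> \<not> w \<rightarrow> x}"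
proof -
  have fin: "finite {w. w \<rightarrow> x \<and> \<not> w \<rightarrow> y}" for x y
    by (rule finite_subset[of _ "verts G"]) auto
  have eq: "{w \<in> verts G. (w \<rightarrow> x) \<noteq> (w \<rightarrow> y)} = {w. w \<rightarrow> x \<and> \<not> w \<rightarrow> y} \<union> {w. w \<rightarrow> y \<and> \<not> w \<rightarrow> x}"
    by auto
  show ?thesis
    unfolding eq by (rule card_Un_disjoint) (use fin[of x y] fin[of y x] in auto)
qed

lemma card_2_walks:
  "\<exists>\<alpha> \<beta> \<gamma>. \<forall>x \<in> verts G. \<forall>y \<in> verts G. x \<noteq> y \<longrightarrow>
    card {z. x \<rightarrow> z \<and> z \<rightarrow> y} = (if x \<rightarrow> y then \<alpha> else if y \<rightarrow> x then \<beta> else \<gamma>)"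
  using doubly_regular by (simp add: num_2_paths_eq_card)

text \<open>
  For \<open>x\<close> and \<open>y\<close> in one part, the in-neighbours of \<open>x\<close> that do not dominate \<open>y\<close> are the middle
  vertices of the 2-paths from \<open>y\<close> to \<open>x\<close>, and there are \<open>\<gamma>\<close> of them. Counting the 2-paths from a
  vertex to the rest of its part gives \<open>4 * (r - 1) * \<gamma> = (m - 1) * r\<^sup>2\<close>. As \<open>r - 1\<close> is coprime to
  \<open>r\<close>, it divides \<open>m - 1\<close>; hence \<open>m \<ge> r\<close>, which is what makes \<open>2 * \<gamma>\<close> reach half the order.
\<close>

lemma half_distinguish_same_part:
  assumes i: "i \<in> {1..m}" and x: "x \<in> V i" and y: "y \<in> V i" and ne: "x \<noteq> y"
  shows "m * r \<le> 2 * card {w \<in> verts G. (w \<rightarrow> x) \<noteq> (w \<rightarrow> y)}"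
proof -
  obtain \<alpha> \<beta> \<gamma> where dr: "\<forall>x \<in> verts G. \<forall>y \<in> verts G. x \<noteq> y \<longrightarrow>
      card {z. x \<rightarrow> z \<and> z \<rightarrow> y} = (if x \<rightarrow> y then \<alpha> else if y \<rightarrow> x then \<beta> else \<gamma>)"
    using card_2_walks by blast
  have paths: "card {z. u \<rightarrow> z \<and> z \<rightarrow> v} = \<gamma>" if "u \<in> V i" "v \<in> V i" "u \<noteq> v" for u v
    using dr[rule_format, of u v] that independent_part[OF i] part_in_verts[OF i] by auto
  have diff: "card {w. w \<rightarrow> u \<and> \<not> w \<rightarrow> v} = \<gamma>" if uv: "u \<in> V i" "v \<in> V i" "u \<noteq> v" for u v
  proof -
    have "w \<rightarrow> u \<and> \<not> w \<rightarrow> v \<longleftrightarrow> v \<rightarrow> w \<and> w \<rightarrow> u" for w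
    proof
      assume w: "w \<rightarrow> u \<and> \<not> w \<rightarrow> v"
      then obtain l where l: "l \<in> {1..m}" "w \<in> V l"
        using adj_in_verts[of w u] by (auto simp: verts_eq)
      then have "l \<noteq> i" using w independent_part[OF i _ uv(1)] by auto
      then show "v \<rightarrow> w \<and> w \<rightarrow> u" using oriented[OF l(1) i _ l(2) uv(2)] w by auto
    qed (use adj_asym in blast)
    then show ?thesis using paths[of v u] uv by simp
  qed
  \<comment> \<open>The term \<open>y = x\<close> vanishes because there are no directed 2-cycles.\<close>
  have "(\<Sum>y\<in>V i. card {z. x \<rightarrow> z \<and> z \<rightarrow> y}) = (\<Sum>y\<in>V i. if y = x then 0 else \<gamma>)"
  proof (rule sum.cong)
    fix y assume "y \<in> V i"
    moreover have "{z. x \<rightarrow> z \<and> z \<rightarrow> x} = {}" using adj_asym by blast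
    then have "card {z. x \<rightarrow> z \<and> z \<rightarrow> x} = 0" by (simp only: card.empty)
    ultimately show "card {z. x \<rightarrow> z \<and> z \<rightarrow> y} = (if y = x then 0 else \<gamma>)"
      using paths[OF x] by auto
  qed simp
  also have "\<dots> = (r - 1) * \<gamma>"
    using finite_part[OF i] x card_part[OF i] by (simp add: sum.remove[of "V i" x])
  finally have count: "4 * ((r - 1) * \<gamma>) = (m - 1) * r * r"
    using sum_card_2_walks_to_part[OF i x i] i by simp
  have "r - 1 dvd (m - 1) * r * r" unfolding count[symmetric] by simp
  moreover have "coprime (r - 1) r"
    using r_gt_1 by (intro coprime_diff_one_left_nat) simp
  ultimately have "r - 1 dvd m - 1"
    by (simp add: coprime_dvd_mult_left_iff)
  then have "r \<le> m" using m_gt_1 r_gt_1 dvd_imp_le[of "r - 1" "m - 1"] by linarith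
  then have "m * (r - 1) \<le> (m - 1) * r"
    by (simp add: diff_mult_distrib diff_mult_distrib2)
  then have "(m * (r - 1)) * r \<le> 4 * ((r - 1) * \<gamma>)"
    unfolding count by (rule mult_le_mono1)
  then have "(r - 1) * (m * r) \<le> (r - 1) * (4 * \<gamma>)" by (simp add: mult_ac)
  then have "m * r \<le> 4 * \<gamma>" using r_gt_1 by simp
  then show ?thesis
    using diff[OF x y ne] diff[OF y x] ne unfolding card_differing_in_neighbours by simp
qed

text \<open>
  For \<open>x \<in> V i\<close> and \<open>y \<in> V j\<close>, the in-neighbours of \<open>x\<close> that do not dominate \<open>y\<close> are half of
  \<open>V j\<close> and the middle vertices of the 2-paths from \<open>y\<close> to \<open>x\<close>. With both orders of \<open>x\<close> and \<open>y\<close>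
  this gives \<open>r + \<alpha> + \<beta>\<close>, whichever way the arc between them points, and counting the 2-paths
  from \<open>x\<close> to \<open>V j\<close> gives \<open>\<alpha> + \<beta> = (m - 2) * r / 2\<close>.
\<close>

lemma half_distinguish_different_parts:
  assumes i: "i \<in> {1..m}" and x: "x \<in> V i" and j: "j \<in> {1..m}" and y: "y \<in> V j" and ne: "i \<noteq> j"
  shows "2 * card {w \<in> verts G. (w \<rightarrow> x) \<noteq> (w \<rightarrow> y)} = m * r"
proof -
  obtain \<alpha> \<beta> \<gamma> where dr: "\<forall>x \<in> verts G. \<forall>y \<in> verts G. x \<noteq> y \<longrightarrow>
      card {z. x \<rightarrow> z \<and> z \<rightarrow> y} = (if x \<rightarrow> y then \<alpha> else if y \<rightarrow> x then \<beta> else \<gamma>)"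
    using card_2_walks by blast
  have paths: "card {z. x \<rightarrow> z \<and> z \<rightarrow> v} = (if x \<rightarrow> v then \<alpha> else \<beta>)"
     "card {z. v \<rightarrow> z \<and> z \<rightarrow> x} = (if v \<rightarrow> x then \<alpha> else \<beta>)" if v: "v \<in> V j" for v
  proof -
    have "x \<noteq> v" using part_unique[OF x _ i j] v ne by auto
    then show "card {z. x \<rightarrow> z \<and> z \<rightarrow> v} = (if x \<rightarrow> v then \<alpha> else \<beta>)"
      "card {z. v \<rightarrow> z \<and> z \<rightarrow> x} = (if v \<rightarrow> x then \<alpha> else \<beta>)"
      using dr[rule_format, of x v] dr[rule_format, of v x] oriented[OF i j ne x v]
        part_in_verts[OF i x] part_in_verts[OF j v] by auto
  qed
  have diff: "2 * card {w. w \<rightarrow> u \<and> \<not> w \<rightarrow> v} = r + 2 * card {z. v \<rightarrow> z \<and> z \<rightarrow> u}"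
    if k: "k \<in> {1..m}" "u \<in> V k" and l: "l \<in> {1..m}" "v \<in> V l" and kl: "k \<noteq> l" for k l u v
  proof -
    have fin: "finite {w \<in> V l. w \<rightarrow> u}" "finite {z. v \<rightarrow> z \<and> z \<rightarrow> u}"
      using finite_part[OF l(1)] by simp (rule finite_subset[of _ "verts G"], auto)
    have "w \<rightarrow> u \<and> \<not> w \<rightarrow> v \<longleftrightarrow> (w \<in> V l \<and> w \<rightarrow> u) \<or> (v \<rightarrow> w \<and> w \<rightarrow> u)" for w
    proof
      assume w: "w \<rightarrow> u \<and> \<not> w \<rightarrow> v"
      then obtain h where h: "h \<in> {1..m}" "w \<in> V h"
        using adj_in_verts[of w u] by (auto simp: verts_eq)
      then show "(w \<in> V l \<and> w \<rightarrow> u) \<or> (v \<rightarrow> w \<and> w \<rightarrow> u)"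
        using oriented[OF h(1) l(1) _ h(2) l(2)] w by (cases "h = l") auto
    qed (use adj_asym independent_part[OF l(1) _ l(2)] in blast)
    then have "{w. w \<rightarrow> u \<and> \<not> w \<rightarrow> v} = {w \<in> V l. w \<rightarrow> u} \<union> {z. v \<rightarrow> z \<and> z \<rightarrow> u}" by blast
    moreover have "{w \<in> V l. w \<rightarrow> u} \<inter> {z. v \<rightarrow> z \<and> z \<rightarrow> u} = {}"
      using independent_part[OF l(1) l(2)] by blast
    ultimately have "card {w. w \<rightarrow> u \<and> \<not> w \<rightarrow> v}
        = card {w \<in> V l. w \<rightarrow> u} + card {z. v \<rightarrow> z \<and> z \<rightarrow> u}"
      using card_Un_disjoint[OF fin] by simp
    then show ?thesis using dominated_by_half[OF k(1) l(1) kl k(2)] by simp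
  qed
  have total: "2 * card {w \<in> verts G. (w \<rightarrow> x) \<noteq> (w \<rightarrow> y)} = 2 * r + 2 * (\<alpha> + \<beta>)"
    using diff[OF i x j y ne] diff[OF j y i x] ne paths[OF y] oriented[OF i j ne x y]
    unfolding card_differing_in_neighbours by auto
  have "(\<Sum>v\<in>V j. card {z. x \<rightarrow> z \<and> z \<rightarrow> v}) = (\<Sum>v\<in>V j. if x \<rightarrow> v then \<alpha> else \<beta>)"
    using paths by (intro sum.cong) auto
  also have "\<dots> = (\<Sum>v\<in>V j. (if x \<rightarrow> v then \<alpha> else 0) + (if v \<rightarrow> x then \<beta> else 0))"
    using oriented[OF i j ne x] by (intro sum.cong) auto
  also have "\<dots> = card {v \<in> V j. x \<rightarrow> v} * \<alpha> + card {v \<in> V j. v \<rightarrow> x} * \<beta>"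
    by (simp add: sum.distrib sum.inter_filter[OF finite_part[OF j], symmetric])
  also have "2 * \<dots> = (2 * card {v \<in> V j. x \<rightarrow> v}) * \<alpha> + (2 * card {v \<in> V j. v \<rightarrow> x}) * \<beta>"
    by simp
  also have "\<dots> = r * (\<alpha> + \<beta>)"
    unfolding dominates_half[OF i j ne x] dominated_by_half[OF i j ne x] card_part[OF j]
    by (simp add: algebra_simps)
  finally have "2 * (r * (\<alpha> + \<beta>)) = card ({1..m} - {i, j}) * r * r"
    using sum_card_2_walks_to_part[OF i x j] by linarith
  moreover have "card ({1..m} - {i, j}) = m - 2"
    using i j ne by (subst card_Diff_subset) auto
  ultimately have "r * (2 * (\<alpha> + \<beta>)) = r * ((m - 2) * r)"
    by (simp only: mult_ac)
  then have "2 * (\<alpha> + \<beta>) = (m - 2) * r" using r_gt_1 by (simp only: mult_left_cancel)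
  moreover have "2 + (m - 2) = m" using m_gt_1 by simp
  then have "m * r = 2 * r + (m - 2) * r" by (metis add_mult_distrib)
  ultimately show ?thesis using total by simp
qed

lemma half_distinguish:
  assumes "x \<in> verts G" "y \<in> verts G" "x \<noteq> y"
  shows "card (verts G) \<le> 2 * card {w \<in> verts G. (w \<rightarrow> x) \<noteq> (w \<rightarrow> y)}"
proof -
  obtain i j where i: "i \<in> {1..m}" "x \<in> V i" and j: "j \<in> {1..m}" "y \<in> V j"
    using assms(1,2) unfolding verts_eq by blast
  show ?thesis
  proof (cases "i = j")
    case True
    then have "y \<in> V i" using j(2) by simp
    from half_distinguish_same_part[OF i this assms(3)] show ?thesis unfolding card_verts .
  next
    case False
    from half_distinguish_different_parts[OF i j False] show ?thesis
      unfolding card_verts by (rule eq_imp_le[OF sym])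
  qed
qed

section \<open>The metric dimension\<close>

text \<open>
  A set \<open>R\<close> that hits every pair of distinct vertices, in the sense that some \<open>w \<in> R\<close> dominates
  exactly one of the two, is resolving: that \<open>w\<close> has distance 1 to just one of them. There are fewer
  than \<open>(m * r)\<^sup>2\<close> pairs, so \<open>s\<close> halvings with \<open>2 ^ s \<ge> (m * r)\<^sup>2\<close> leave none.
\<close>

lemma metric_dimension_le:
  assumes s: "(m * r)\<^sup>2 \<le> 2 ^ s"
  shows "metric_dimension G \<le> s"
proof -
  define P where "P = {(u, v). u \<in> verts G \<and> v \<in> verts G \<and> u \<noteq> v}"
  define hits :: "'a \<Rightarrow> 'a \<times> 'a \<Rightarrow> bool" where "hits = (\<lambda>w (u, v). (w \<rightarrow> u) \<noteq> (w \<rightarrow> v))"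
  have mr: "m * r > 0" using m_gt_1 r_gt_1 by simp
  then have ne: "verts G \<noteq> {}" using card_verts by auto
  have "P \<subset> verts G \<times> verts G" using ne unfolding P_def by blast
  moreover have fin: "finite (verts G \<times> verts G)" by simp
  ultimately have finP: "finite P" and "card P < card (verts G \<times> verts G)"
    using psubset_card_mono[OF fin] finite_subset[OF _ fin] by blast+
  then have cardP: "card P < (m * r)\<^sup>2"
    by (simp only: card_cartesian_product card_verts power2_eq_square)
  have half: "card (verts G) \<le> 2 * card {w \<in> verts G. hits w p}" if "p \<in> P" for p
  proof -
    obtain u v where p: "p = (u, v)" by (cases p)
    then have "u \<in> verts G" "v \<in> verts G" "u \<noteq> v" using that by (simp_all add: P_def)
    then show ?thesis unfolding p hits_def prod.case by (rule half_distinguish)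
  qed
  obtain R where R: "R \<subseteq> verts G" "card R \<le> s"
    and left: "2 ^ s * card {p \<in> P. \<forall>w \<in> R. \<not> hits w p} \<le> card P"
    using halving_hitting_set[where hits = hits and s = s, OF finite_verts finP ne half] by auto
  have "card {p \<in> P. \<forall>w \<in> R. \<not> hits w p} = 0"
  proof (rule ccontr)
    assume "card {p \<in> P. \<forall>w \<in> R. \<not> hits w p} \<noteq> 0"
    then have "2 ^ s * 1 \<le> 2 ^ s * card {p \<in> P. \<forall>w \<in> R. \<not> hits w p}" by (intro mult_le_mono2) simp
    then show False using order.strict_trans2[OF cardP s] left by linarith
  qed
  then have none: "{p \<in> P. \<forall>w \<in> R. \<not> hits w p} = {}" using finP by simp
  have "resolving_set G R"
    unfolding resolving_set_def
  proof (intro conjI ballI impI)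
    fix u v assume "u \<in> verts G - R" "v \<in> verts G - R" "u \<noteq> v"
    then have "(u, v) \<in> P" by (simp add: P_def)
    then obtain w where w: "w \<in> R" "hits w (u, v)" using none by blast
    then have wG: "w \<in> verts G" and "(w \<rightarrow> u) \<noteq> (w \<rightarrow> v)" using R(1) by (auto simp: hits_def)
    then have "distance G w u \<noteq> distance G w v"
      using distance_eq_1_iff[OF wG, of u] distance_eq_1_iff[OF wG, of v] by metis
    then show "\<exists>w\<in>R. distance G w u \<noteq> distance G w v" using w(1) by blast
  qed (rule R)
  then show ?thesis using metric_dimension_le_card R(2) order_trans by blast
qed

end

text \<open>
  Since \<open>ln 2 \<ge> 1 / 2\<close>, the power of 2 is at least \<open>exp (2 * ln n) = n\<^sup>2\<close>.
\<close>

lemma square_le_two_power_ceiling_4_ln: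
  assumes "n > 0"
  shows "n\<^sup>2 \<le> 2 ^ nat \<lceil>4 * ln (real n)\<rceil>"
proof -
  let ?s = "nat \<lceil>4 * ln (real n)\<rceil>"
  have ln_n: "ln (real n) \<ge> 0" using assms by simp
  have "ln (2::real) \<ge> 1 / 2" using ln_le_minus_one[of "1 / 2 :: real"] by (simp add: ln_div)
  then have "2 * ln (real n) \<le> (4 * ln (real n)) * ln 2"
    using mult_left_mono[of "1/2" "ln (2::real)" "4 * ln (real n)"] ln_n by simp
  also have "\<dots> \<le> real ?s * ln 2"
    by (rule mult_right_mono) (auto intro: real_nat_ceiling_ge)
  finally have "ln ((real n)\<^sup>2) \<le> ln (2 ^ ?s)" using assms by (simp add: ln_realpow)
  then have "(real n)\<^sup>2 \<le> 2 ^ ?s"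
    using assms ln_le_cancel_iff[of "(real n)\<^sup>2" "2 ^ ?s"] by simp
  then show ?thesis by (metis of_nat_le_iff of_nat_numeral of_nat_power)
qed

theorem theorem2p15:
  fixes D :: "('a, 'b) pre_digraph" and m r n :: nat and V :: "nat \<Rightarrow> 'a set"
  assumes "doubly_regular_team_tournament_type_II D m r V"
    and "n = m * r"
    and "n \<ge> 27"
  shows "localization_number D \<le> metric_dimension D \<and>
    int (metric_dimension D) \<le> \<lceil>4 * ln (real n)\<rceil>"
proof -
  interpret doubly_regular_team_tournament_type_II D m r V by fact
  have n: "n > 0" using assms(3) by simp
  have "metric_dimension D \<le> nat \<lceil>4 * ln (real n)\<rceil>"
    using metric_dimension_le square_le_two_power_ceiling_4_ln[OF n] assms(2) by simp
  moreover have "0 \<le> \<lceil>4 * ln (real n)\<rceil>"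
    using n by (simp add: order_less_le_trans[of _ 0])
  ultimately show ?thesis
    using localization_number_le_metric_dimension by (simp add: le_nat_iff)
qed

end
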